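(* $\mathcal{K}(\ell_1)$ is ball proximinal in $\mathcal{B}(\ell_1)$, and $$d(T,B_{\mathcal{K}(\ell_1)})=\max\{\|T\|-1,\,d(T,\mathcal{K}(\ell_1))\}\quad\text{for all } T\in\mathcal{B}(\ell_1).$$
   Context: $\ell_1$ is the Banach space of absolutely summable sequences with its usual norm. $\mathcal{B}(\ell_1)$ is the space of bounded linear operators on $\ell_1$ with the operator norm, and $\mathcal{K}(\ell_1)$ is the subspace of compact operators. For a Banach space $Y$, $B_Y$ denotes its closed unit ball. For a non-empty closed subset $K$ of a Banach space $Z$ and $z\in Z$, $d(z,K)=\inf_{k\in K}\|z-k\|$; $K$ is proximinal in $Z$ if for every $z\in Z$ there is $k\in K$ with $\|z-k\|=d(z,K)$. A closed subspace $Y$ of $Z$ is ball proximinal in $Z$ if $B_Y$ is proximinal in $Z$. *)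

theory Defs
  imports "HOL-Analysis.Analysis"
begin

typedef (overloaded) ('k::real_normed_vector) l1 =
  "{x :: nat \<Rightarrow> 'k. summable (\<lambda>n. norm (x n))}"
  morphisms l1_nth Abs_l1
  by (rule exI[of _ "\<lambda>_. 0"]) simp

setup_lifting type_definition_l1

lemma summable_l1_nth: "summable (\<lambda>n. norm (l1_nth x n))"
  using l1_nth[of x] by simp

lemma l1_eqI: "(\<And>n. l1_nth x n = l1_nth y n) \<Longrightarrow> x = y"
  by (simp add: l1_nth_inject[symmetric] fun_eq_iff)

instantiation l1 :: (real_normed_vector) real_vector
begin

lift_definition zero_l1 :: "'a l1" is "\<lambda>_. 0" by simp

lift_definition plus_l1 :: "'a l1 \<Rightarrow> 'a l1 \<Rightarrow> 'a l1" is "\<lambda>x y n. x n + y n"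
proof -
  fix x y :: "nat \<Rightarrow> 'a"
  assume "summable (\<lambda>n. norm (x n))" "summable (\<lambda>n. norm (y n))"
  then have "summable (\<lambda>n. norm (x n) + norm (y n))" by (rule summable_add)
  then show "summable (\<lambda>n. norm (x n + y n))"
    by (rule summable_comparison_test'[where N = 0]) (simp add: norm_triangle_ineq)
qed

lift_definition uminus_l1 :: "'a l1 \<Rightarrow> 'a l1" is "\<lambda>x n. - x n" by simp

lift_definition minus_l1 :: "'a l1 \<Rightarrow> 'a l1 \<Rightarrow> 'a l1" is "\<lambda>x y n. x n - y n"
proof -
  fix x y :: "nat \<Rightarrow> 'a"
  assume "summable (\<lambda>n. norm (x n))" "summable (\<lambda>n. norm (y n))"
  then have "summable (\<lambda>n. norm (x n) + norm (y n))" by (rule summable_add)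
  then show "summable (\<lambda>n. norm (x n - y n))"
    by (rule summable_comparison_test'[where N = 0]) (simp add: norm_triangle_ineq4)
qed

lift_definition scaleR_l1 :: "real \<Rightarrow> 'a l1 \<Rightarrow> 'a l1" is "\<lambda>r x n. r *\<^sub>R x n"
  by (simp add: summable_mult)

instance
  by standard (transfer; simp add: fun_eq_iff algebra_simps)+

end

instantiation l1 :: (real_normed_vector) real_normed_vector
begin

lift_definition norm_l1 :: "'a l1 \<Rightarrow> real" is "\<lambda>x. \<Sum>n. norm (x n)" .

definition dist_l1 :: "'a l1 \<Rightarrow> 'a l1 \<Rightarrow> real"
  where "dist_l1 x y = norm (x - y)"

definition sgn_l1 :: "'a l1 \<Rightarrow> 'a l1"
  where "sgn_l1 x = x /\<^sub>R norm x"

definition uniformity_l1 :: "('a l1 \<times> 'a l1) filter"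
  where "uniformity_l1 = (INF e\<in>{0<..}. principal {(x, y). dist x y < e})"

definition open_l1 :: "'a l1 set \<Rightarrow> bool"
  where "open_l1 U \<longleftrightarrow> (\<forall>x\<in>U. \<forall>\<^sub>F (x', y) in uniformity. x' = x \<longrightarrow> y \<in> U)"

instance
proof
  fix x y :: "'a l1" and r :: real
  show "norm x = 0 \<longleftrightarrow> x = 0"
    by transfer (auto simp: suminf_eq_zero_iff fun_eq_iff)
  show "norm (x + y) \<le> norm x + norm y"
  proof transfer
    fix x y :: "nat \<Rightarrow> 'a"
    assume xy: "summable (\<lambda>n. norm (x n))" "summable (\<lambda>n. norm (y n))"
    then have s: "summable (\<lambda>n. norm (x n) + norm (y n))" by (rule summable_add)
    then have "summable (\<lambda>n. norm (x n + y n))"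
      by (rule summable_comparison_test'[where N = 0]) (simp add: norm_triangle_ineq)
    then have "(\<Sum>n. norm (x n + y n)) \<le> (\<Sum>n. norm (x n) + norm (y n))"
      using s by (intro suminf_le) (auto simp: norm_triangle_ineq)
    then show "(\<Sum>n. norm (x n + y n)) \<le> (\<Sum>n. norm (x n)) + (\<Sum>n. norm (y n))"
      using xy by (simp add: suminf_add)
  qed
  show "norm (r *\<^sub>R x) = \<bar>r\<bar> * norm x"
    by transfer (simp add: suminf_mult)
qed (simp_all add: dist_l1_def sgn_l1_def uniformity_l1_def open_l1_def)

end

lemma norm_l1_nth_le: "norm (l1_nth x n) \<le> norm x"
  using sum_le_suminf[OF summable_l1_nth, of "{n}" x] by (simp add: norm_l1.rep_eq)

lemma sum_norm_l1_le: "(\<Sum>n<N. norm (l1_nth x n)) \<le> norm x"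
  using sum_le_suminf[OF summable_l1_nth, of "{..<N}" x] by (simp add: norm_l1.rep_eq)

instance l1 :: (banach) banach
proof
  fix X :: "nat \<Rightarrow> 'a l1"
  assume X: "Cauchy X"
  have "Cauchy (\<lambda>i. l1_nth (X i) n)" for n
  proof (rule metric_CauchyI)
    fix e :: real assume "0 < e"
    then obtain M where M: "\<And>i j. i \<ge> M \<Longrightarrow> j \<ge> M \<Longrightarrow> dist (X i) (X j) < e"
      using X unfolding Cauchy_def by blast
    have "dist (l1_nth (X i) n) (l1_nth (X j) n) \<le> dist (X i) (X j)" for i j
      using norm_l1_nth_le[of "X i - X j" n] by (simp add: dist_norm minus_l1.rep_eq)
    with M show "\<exists>M. \<forall>i\<ge>M. \<forall>j\<ge>M. dist (l1_nth (X i) n) (l1_nth (X j) n) < e"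
      by (meson le_less_trans)
  qed
  then have "\<forall>n. \<exists>l. (\<lambda>i. l1_nth (X i) n) \<longlonglongrightarrow> l"
    by (simp add: Cauchy_convergent_iff convergent_def)
  then obtain y where y: "\<And>n. (\<lambda>i. l1_nth (X i) n) \<longlonglongrightarrow> y n" by metis
  have tail: "\<exists>M. \<forall>i\<ge>M. \<forall>N. (\<Sum>n<N. norm (l1_nth (X i) n - y n)) \<le> e" if "0 < e" for e
  proof -
    obtain M where M: "\<And>i j. i \<ge> M \<Longrightarrow> j \<ge> M \<Longrightarrow> dist (X i) (X j) < e"
      using X \<open>0 < e\<close> unfolding Cauchy_def by blast
    have "(\<Sum>n<N. norm (l1_nth (X i) n - y n)) \<le> e" if "i \<ge> M" for i N
    proof (rule tendsto_upperbound)
      show "(\<lambda>j. \<Sum>n<N. norm (l1_nth (X i) n - l1_nth (X j) n))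
              \<longlonglongrightarrow> (\<Sum>n<N. norm (l1_nth (X i) n - y n))"
        by (intro tendsto_intros y)
      have "(\<Sum>n<N. norm (l1_nth (X i) n - l1_nth (X j) n)) \<le> e" if "j \<ge> M" for j
        using sum_norm_l1_le[of "X i - X j" N] M[OF \<open>i \<ge> M\<close> that]
        by (simp add: dist_norm minus_l1.rep_eq)
      then show "\<forall>\<^sub>F j in sequentially. (\<Sum>n<N. norm (l1_nth (X i) n - l1_nth (X j) n)) \<le> e"
        by (auto simp: eventually_sequentially)
    qed simp
    then show ?thesis by blast
  qed
  have summ: "summable (\<lambda>n. norm (l1_nth (X i) n - y n))"
    and le: "(\<Sum>n. norm (l1_nth (X i) n - y n)) \<le> e"
    if "\<And>N. (\<Sum>n<N. norm (l1_nth (X i) n - y n)) \<le> e" for i e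
  proof -
    show *: "summable (\<lambda>n. norm (l1_nth (X i) n - y n))"
      using that by (intro bounded_imp_summable[where B = e])
        (auto simp: lessThan_Suc_atMost[symmetric] simp del: sum.lessThan_Suc)
    show "(\<Sum>n. norm (l1_nth (X i) n - y n)) \<le> e"
      using that by (intro suminf_le_const[OF *])
  qed
  obtain M1 where M1: "\<And>N. (\<Sum>n<N. norm (l1_nth (X M1) n - y n)) \<le> 1"
    using tail[of 1] by auto
  have "summable (\<lambda>n. norm (l1_nth (X M1) n) + norm (l1_nth (X M1) n - y n))"
    using summable_l1_nth summ[OF M1] by (rule summable_add)
  then have "summable (\<lambda>n. norm (y n))"
    by (rule summable_comparison_test'[where N = 0])
       (use norm_triangle_ineq4[of "l1_nth (X M1) n" "l1_nth (X M1) n - y n" for n] in auto)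
  then have Y: "l1_nth (Abs_l1 y) = y" by (simp add: Abs_l1_inverse)
  have "X \<longlonglongrightarrow> Abs_l1 y"
  proof (rule metric_LIMSEQ_I)
    fix r :: real assume "0 < r"
    then obtain M where M: "\<And>i N. i \<ge> M \<Longrightarrow> (\<Sum>n<N. norm (l1_nth (X i) n - y n)) \<le> r / 2"
      using tail[of "r / 2"] by auto
    have "dist (X i) (Abs_l1 y) \<le> r / 2" if "i \<ge> M" for i
      using le[OF M[OF that]] by (simp add: dist_norm norm_l1.rep_eq minus_l1.rep_eq Y)
    with \<open>0 < r\<close> show "\<exists>no. \<forall>n\<ge>no. dist (X n) (Abs_l1 y) < r"
      by (intro exI[of _ M]) (force intro: le_less_trans)
  qed
  then show "convergent X" by (auto simp: convergent_def)
qed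

lift_definition l1_scale :: "'k::real_normed_field \<Rightarrow> 'k l1 \<Rightarrow> 'k l1" is "\<lambda>c x n. c * x n"
  by (simp add: norm_mult summable_mult)

(* Scalars: a real normed field whose bounded closed sets are compact is (isometrically) the
   reals or the complex numbers, and both are instances, so results about 'k l1 cover real
   and complex l1 at once.  The type of bounded linear maps only expresses real linearity,
   hence the explicit condition below; it is vacuous for real scalars. *)
definition l1_operators ::
    "('k::{real_normed_field,heine_borel} l1 \<Rightarrow>\<^sub>L 'k l1) set"
  where "l1_operators = {T. \<forall>c x. blinfun_apply T (l1_scale c x) = l1_scale c (blinfun_apply T x)}"

lemma l1_operators_real: "(l1_operators :: (real l1 \<Rightarrow>\<^sub>L real l1) set) = UNIV"
proof -
  have "l1_scale c x = c *\<^sub>R x" for c and x :: "real l1"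
    by transfer simp
  then show ?thesis by (simp add: l1_operators_def blinfun.scaleR_right)
qed

definition l1_compact_operators ::
    "('k::{real_normed_field,heine_borel} l1 \<Rightarrow>\<^sub>L 'k l1) set"
  where "l1_compact_operators =
    {T \<in> l1_operators. compact (closure (blinfun_apply T ` cball 0 1))}"

definition unit_ball :: "'a::real_normed_vector set \<Rightarrow> 'a set"
  where "unit_ball Y = {y \<in> Y. norm y \<le> 1}"

definition proximinal_in :: "'a::real_normed_vector set \<Rightarrow> 'a set \<Rightarrow> bool"
  where "proximinal_in K Z \<longleftrightarrow> K \<noteq> {} \<and> closed K \<and> K \<subseteq> Z \<and>
    (\<forall>z\<in>Z. \<exists>k\<in>K. norm (z - k) = infdist z K)"

definition ball_proximinal_in :: "'a::real_normed_vector set \<Rightarrow> 'a set \<Rightarrow> bool"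
  where "ball_proximinal_in Y Z \<longleftrightarrow> subspace Y \<and> closed Y \<and> Y \<subseteq> Z \<and>
    proximinal_in (unit_ball Y) Z"

end

(* An operator on l1 is determined by its columns T e_j; its norm is the supremum of their norms, and
   it is compact iff the tails of the columns are uniformly small.  Put
   d = max (|T| - 1) (dist (T, compacts)) and remove from every column its last d units of l1 mass
   (everything, if the column has norm at most d).  A removed piece has norm at most d, what is left
   of a column has norm at most max (|T| - d) 0 \<le> 1, and a tail of size t is left with
   max (t - d) 0.  Since T is within d + e of a compact operator for every e > 0, its column tails
   are eventually at most d + e, so the trimmed columns define a compact operator of norm at most 1
   at distance at most d from T. *)
theory Submission
  imports Defs
begin

section \<open>Absolute convergence and pointwise subsequences\<close>

(* The library states these two facts for the class banach, which is not inferred from heine_borel. *)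
lemma summable_norm_cancel_complete:
  fixes f :: "nat \<Rightarrow> 'a::{real_normed_vector,complete_space}"
  assumes "summable (\<lambda>n. norm (f n))"
  shows "summable f"
proof -
  let ?g = "\<lambda>n. norm (f n)"
  have C: "Cauchy (\<lambda>N. \<Sum>n<N. ?g n)"
    using assms by (simp add: summable_iff_convergent Cauchy_convergent_iff)
  have le: "norm ((\<Sum>n<j. f n) - (\<Sum>n<i. f n)) \<le> norm ((\<Sum>n<j. ?g n) - (\<Sum>n<i. ?g n))"
    if "i \<le> j" for i j
  proof -
    have "(\<Sum>n<j. f n) - (\<Sum>n<i. f n) = (\<Sum>n=i..<j. f n)"
      "(\<Sum>n<j. ?g n) - (\<Sum>n<i. ?g n) = (\<Sum>n=i..<j. ?g n)"
      using sum_diff_nat_ivl[of 0 i j f] sum_diff_nat_ivl[of 0 i j ?g] that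
      by (simp_all add: atLeast0LessThan)
    then show ?thesis
      using norm_sum[of f "{i..<j}"] by (metis abs_of_nonneg norm_ge_zero order_trans real_norm_def)
  qed
  have "dist (\<Sum>n<i. f n) (\<Sum>n<j. f n) \<le> dist (\<Sum>n<i. ?g n) (\<Sum>n<j. ?g n)" for i j
    using le[of i j] le[of j i] by (cases "i \<le> j") (simp_all add: dist_norm norm_minus_commute)
  then have "Cauchy (\<lambda>N. \<Sum>n<N. f n)"
    using C unfolding Cauchy_def by (meson le_less_trans)
  then show ?thesis
    by (simp add: summable_iff_convergent Cauchy_convergent_iff)
qed

lemma norm_suminf_le_complete:
  fixes f :: "nat \<Rightarrow> 'a::{real_normed_vector,complete_space}"
  assumes "summable (\<lambda>n. norm (f n))"
  shows "norm (suminf f) \<le> (\<Sum>n. norm (f n))"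
proof (rule LIMSEQ_le)
  show "(\<lambda>N. norm (\<Sum>n<N. f n)) \<longlonglongrightarrow> norm (suminf f)"
    using summable_norm_cancel_complete[OF assms] by (intro tendsto_norm summable_LIMSEQ)
  show "(\<lambda>N. \<Sum>n<N. norm (f n)) \<longlonglongrightarrow> (\<Sum>n. norm (f n))"
    using assms by (rule summable_LIMSEQ)
qed (use norm_sum in blast)

text \<open>Tychonoff replaces a diagonal argument: the sequences lie in a countable product of
  compact balls, whose topology is first countable, so compactness yields a convergent subsequence,
  and the coordinate projections are continuous.\<close>

lemma pointwise_convergent_subseq:
  fixes f :: "nat \<Rightarrow> nat \<Rightarrow> 'a::{real_normed_vector,heine_borel}"
  assumes "\<And>m n. norm (f m n) \<le> B"
  obtains l r where "strict_mono (r :: nat \<Rightarrow> nat)" "\<And>n. (\<lambda>m. f (r m) n) \<longlonglongrightarrow> l n"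
proof -
  let ?A = "PiE UNIV (\<lambda>_::nat. cball (0::'a) B)"
  have "compactin (product_topology (\<lambda>_::nat. euclidean) UNIV) ?A"
    by (subst compactin_PiE) auto
  then have "seq_compact ?A"
    by (simp add: euclidean_product_topology compact_imp_seq_compact)
  moreover have "f m \<in> ?A" for m
    using assms by auto
  ultimately obtain l r where r: "strict_mono (r :: nat \<Rightarrow> nat)" "(f \<circ> r) \<longlonglongrightarrow> l"
    unfolding seq_compact_def by metis
  have "(\<lambda>m. f (r m) n) \<longlonglongrightarrow> l n" for n
    using continuous_on_tendsto_compose[OF continuous_on_product_coordinates r(2), of n] by simp
  with r(1) show ?thesis by (rule that)
qed

section \<open>Tails of summable sequences\<close>

text \<open>The seminorm measuring the distance from \<open>x\<close> to the sequences supported on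
  the first \<open>N\<close> coordinates. At \<open>N = 0\<close> it is the norm, so a norm estimate
  is a special case of a tail estimate.\<close>

definition l1_tail :: "nat \<Rightarrow> 'a::real_normed_vector l1 \<Rightarrow> real"
  where "l1_tail N x = (\<Sum>i. norm (l1_nth x (i + N)))"

lemma summable_l1_tail: "summable (\<lambda>i. norm (l1_nth x (i + N)))"
  using summable_l1_nth by (rule summable_ignore_initial_segment)

lemma l1_tail_nonneg: "0 \<le> l1_tail N x"
  unfolding l1_tail_def by (intro suminf_nonneg summable_l1_tail) simp

lemma l1_tail_0: "l1_tail 0 x = norm x"
  by (simp add: l1_tail_def norm_l1.rep_eq)

lemma l1_tail_split: "norm x = (\<Sum>i<N. norm (l1_nth x i)) + l1_tail N x"
  using suminf_split_initial_segment[OF summable_l1_nth, of x N]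
  by (simp add: l1_tail_def norm_l1.rep_eq)

lemma l1_tail_le_norm: "l1_tail N x \<le> norm x"
  using l1_tail_split[of x N] sum_nonneg[of "{..<N}" "\<lambda>i. norm (l1_nth x i)"] by simp

lemma l1_tail_Suc: "l1_tail N x = norm (l1_nth x N) + l1_tail (Suc N) x"
  using l1_tail_split[of x N] l1_tail_split[of x "Suc N"] by simp

lemma l1_tail_antimono: "M \<le> N \<Longrightarrow> l1_tail N x \<le> l1_tail M x"
proof (rule lift_Suc_antimono_le[of "\<lambda>N. l1_tail N x"])
  show "l1_tail (Suc n) x \<le> l1_tail n x" for n
    using l1_tail_Suc[of n x] by simp
qed

lemma l1_tail_tendsto_0: "(\<lambda>N. l1_tail N x) \<longlonglongrightarrow> 0"
proof -
  have "(\<lambda>N. norm x - (\<Sum>i<N. norm (l1_nth x i))) \<longlonglongrightarrow> norm x - norm x"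
    using summable_LIMSEQ[OF summable_l1_nth[of x]]
    by (intro tendsto_diff tendsto_const) (simp add: norm_l1.rep_eq)
  moreover have "l1_tail N x = norm x - (\<Sum>i<N. norm (l1_nth x i))" for N
    using l1_tail_split[of x N] by simp
  ultimately show ?thesis by simp
qed

lemma l1_tail_triangle: "l1_tail N (x + y) \<le> l1_tail N x + l1_tail N y"
  unfolding l1_tail_def suminf_add[OF summable_l1_tail summable_l1_tail]
  by (intro suminf_le summable_add summable_l1_tail) (simp add: plus_l1.rep_eq norm_triangle_ineq)

text \<open>Lets a tail bound pass from a point of a net, or from a column of a nearby operator, to
  \<open>x\<close> at the cost of the distance.\<close>

lemma l1_tail_le_add_dist: "l1_tail N x \<le> l1_tail N y + norm (x - y)"
  using l1_tail_triangle[of N y "x - y"] l1_tail_le_norm[of N "x - y"] by simp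

lemma l1_tail_zero [simp]: "l1_tail N 0 = 0"
  by (simp add: l1_tail_def zero_l1.rep_eq)

lemma l1_tail_sum: "l1_tail N (sum f A) \<le> (\<Sum>i\<in>A. l1_tail N (f i))"
proof (induction A rule: infinite_finite_induct)
  case (insert a A)
  then show ?case using l1_tail_triangle[of N "f a" "sum f A"] by simp
qed simp_all

lemma l1_tail_scaleR: "l1_tail N (r *\<^sub>R x) = \<bar>r\<bar> * l1_tail N x"
  by (simp add: l1_tail_def scaleR_l1.rep_eq suminf_mult summable_l1_tail)

lemma l1_tail_l1_scale: "l1_tail N (l1_scale c x) = norm c * l1_tail N x"
  by (simp add: l1_tail_def l1_scale.rep_eq norm_mult suminf_mult summable_l1_tail)

lemma norm_l1_scale: "norm (l1_scale c x) = norm c * norm x"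
  using l1_tail_l1_scale[of 0 c x] by (simp add: l1_tail_0)

section \<open>Relative compactness in l1 as uniform smallness of tails\<close>

lemma compact_imp_uniform_l1_tail:
  fixes S :: "'a::real_normed_vector l1 set"
  assumes "compact S" "0 < e"
  obtains N where "\<And>y. y \<in> S \<Longrightarrow> l1_tail N y \<le> e"
proof -
  \<comment> \<open>A finite \<open>e/2\<close>-net: each centre has some tail below
    \<open>e/2\<close>, and since tails decrease in the cutoff, the largest of the finitely many
    cutoffs serves all centres.\<close>
  obtain k where k: "finite k" "S \<subseteq> (\<Union>x\<in>k. ball x (e/2))"
    using assms compact_eq_totally_bounded half_gt_zero by metis
  have "\<forall>x :: 'a l1. \<exists>N. l1_tail N x < e/2"
    using order_tendstoD(2)[OF l1_tail_tendsto_0] assms(2)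
    by (metis eventually_sequentially half_gt_zero order_refl)
  then obtain N where N: "\<And>x :: 'a l1. l1_tail (N x) x < e/2" by metis
  obtain M where M: "\<And>x. x \<in> k \<Longrightarrow> N x \<le> M"
    using finite_nat_set_iff_bounded_le[of "N ` k"] k(1) by auto
  have "l1_tail M y \<le> e" if "y \<in> S" for y
  proof -
    obtain x where x: "x \<in> k" "norm (y - x) < e/2"
      using subsetD[OF k(2) \<open>y \<in> S\<close>] by (auto simp: dist_norm norm_minus_commute)
    then show ?thesis
      using l1_tail_le_add_dist[of M y x] l1_tail_antimono[OF M[OF x(1)], of x] N[of x] by simp
  qed
  then show ?thesis by (rule that)
qed

text \<open>Boundedness gives a coordinatewise convergent subsequence. Finitely many coordinates
  then converge in sum, and the uniform tails control the rest, so the convergence is in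
  norm.\<close>

lemma compact_closure_if_uniform_l1_tail:
  fixes S :: "'a::{real_normed_vector,heine_borel} l1 set"
  assumes bdd: "\<And>y. y \<in> S \<Longrightarrow> norm y \<le> B"
    and tl: "\<And>e. 0 < e \<Longrightarrow> \<exists>N. \<forall>y\<in>S. l1_tail N y \<le> e"
  shows "compact (closure S)"
proof -
  obtain N where N: "\<And>e y. 0 < e \<Longrightarrow> y \<in> S \<Longrightarrow> l1_tail (N e) y \<le> e"
    using tl by metis
  \<comment> \<open>\<open>A\<close> contains \<open>S\<close> and uses one fixed cutoff function
    \<open>N\<close>. Its defining bounds survive coordinatewise limits, so limits stay in
    \<open>A\<close>, whereas they may leave \<open>S\<close>.\<close>
  define A where "A = {y :: 'a l1. norm y \<le> B \<and> (\<forall>e>0. l1_tail (N e) y \<le> e)}"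
  have "seq_compact A"
  proof (rule seq_compactI)
    fix f :: "nat \<Rightarrow> 'a l1" assume f: "\<forall>n. f n \<in> A"
    have "norm (l1_nth (f m) n) \<le> B" for m n
      using f by (intro order_trans[OF norm_l1_nth_le]) (simp add: A_def)
    then obtain l r where r: "strict_mono (r :: nat \<Rightarrow> nat)"
      and l: "\<And>n. (\<lambda>m. l1_nth (f (r m)) n) \<longlonglongrightarrow> l n"
      using pointwise_convergent_subseq[of "\<lambda>m. l1_nth (f m)" B] by metis
    \<comment> \<open>Fatou: upper bounds for tails pass to coordinatewise limits.\<close>
    have lim: "(\<Sum>i<K. norm (l (i + M))) \<le> C" if "\<And>m. l1_tail M (f m) \<le> C" for M C K
    proof (rule LIMSEQ_le_const2)
      show "(\<lambda>m. \<Sum>i<K. norm (l1_nth (f (r m)) (i + M))) \<longlonglongrightarrow> (\<Sum>i<K. norm (l (i + M)))"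
        by (intro tendsto_intros l)
      have "(\<Sum>i<K. norm (l1_nth (f (r m)) (i + M))) \<le> C" for m
        using sum_le_suminf[OF summable_l1_tail, of "{..<K}" "f (r m)" M] that[of "r m"]
        by (simp add: l1_tail_def)
      then show "\<exists>n. \<forall>m\<ge>n. (\<Sum>i<K. norm (l1_nth (f (r m)) (i + M))) \<le> C" by blast
    qed
    have B: "\<And>m. l1_tail 0 (f m) \<le> B"
      using f by (simp add: A_def l1_tail_0)
    have "summable (\<lambda>n. norm (l n))"
      using lim[OF B] by (intro bounded_imp_summable[where B = B])
        (auto simp: lessThan_Suc_atMost[symmetric] simp del: sum.lessThan_Suc)
    then have Y: "l1_nth (Abs_l1 l) = l" by (simp add: Abs_l1_inverse)
    let ?y = "Abs_l1 l"
    have tail_y: "l1_tail M ?y \<le> C" if "\<And>m. l1_tail M (f m) \<le> C" for M C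
      unfolding l1_tail_def using lim[OF that] summable_l1_tail[of ?y M]
      by (intro suminf_le_const) (simp_all add: Y)
    have fN: "l1_tail (N e) (f m) \<le> e" if "0 < e" for e m
      using f that by (simp add: A_def)
    have yA: "?y \<in> A"
      using tail_y[OF B] tail_y[OF fN] by (simp add: A_def l1_tail_0)
    have "(f \<circ> r) \<longlonglongrightarrow> ?y"
    proof (rule metric_LIMSEQ_I)
      fix e :: real assume "0 < e"
      \<comment> \<open>The budget: the first \<open>M\<close> coordinates contribute less than
        \<open>e/2\<close>, the tails of \<open>f (r m)\<close> and of the limit at most
        \<open>e/4\<close> each.\<close>
      define M where "M = N (e/4)"
      have "(\<lambda>m. \<Sum>i<M. norm (l1_nth (f (r m)) i - l i)) \<longlonglongrightarrow> (\<Sum>i<M. norm (l i - l i))"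
        by (intro tendsto_intros l)
      then have "\<forall>\<^sub>F m in sequentially. (\<Sum>i<M. norm (l1_nth (f (r m)) i - l i)) < e/2"
        by (rule order_tendstoD(2)) (simp add: \<open>0 < e\<close>)
      then obtain m0 where m0: "\<And>m. m \<ge> m0 \<Longrightarrow> (\<Sum>i<M. norm (l1_nth (f (r m)) i - l i)) < e/2"
        by (auto simp: eventually_sequentially)
      have "dist ((f \<circ> r) m) ?y < e" if "m \<ge> m0" for m
      proof -
        have "l1_tail M (f (r m) - ?y) \<le> l1_tail M (f (r m)) + l1_tail M ?y"
          using l1_tail_triangle[of M "f (r m)" "(-1) *\<^sub>R ?y"] l1_tail_scaleR[of M "-1" ?y] by simp
        also have "\<dots> \<le> e/4 + e/4"
          using fN[of "e/4" "r m"] tail_y[OF fN, of "e/4"] \<open>0 < e\<close> by (simp add: M_def)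
        finally show ?thesis
          using m0[OF that] l1_tail_split[of "f (r m) - ?y" M]
          by (simp add: dist_norm minus_l1.rep_eq Y)
      qed
      then show "\<exists>m0. \<forall>m\<ge>m0. dist ((f \<circ> r) m) ?y < e" by blast
    qed
    with yA r show "\<exists>l\<in>A. \<exists>r. strict_mono r \<and> (f \<circ> r) \<longlonglongrightarrow> l" by blast
  qed
  then have A: "compact A" by (simp add: compact_eq_seq_compact_metric)
  have "S \<subseteq> A" using bdd N by (auto simp: A_def)
  then have "closure S \<subseteq> A" using A by (simp add: closure_minimal compact_imp_closed)
  then show ?thesis
    using compact_Int_closed[OF A closed_closure, of S] by (simp add: Int_absorb1)
qed

section \<open>Columns of operators\<close>

lift_definition l1_unit :: "nat \<Rightarrow> 'k::real_normed_field l1"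
  is "\<lambda>j n. if n = j then 1 else 0"
  by (rule summable_finite[of "{_}"]) auto

lemma norm_l1_unit [simp]: "norm (l1_unit j :: 'k::real_normed_field l1) = 1"
proof -
  have "(\<lambda>n. norm (l1_nth (l1_unit j :: 'k l1) n)) = (\<lambda>n. if n = j then 1 else 0)"
    by (auto simp: l1_unit.rep_eq)
  then show ?thesis
    using sums_single[of j "\<lambda>_. 1 :: real"] by (simp add: norm_l1.rep_eq sums_iff)
qed

lemma l1_nth_sum: "l1_nth (sum f A) n = (\<Sum>i\<in>A. l1_nth (f i) n)"
  by (induction A rule: infinite_finite_induct) (simp_all add: zero_l1.rep_eq plus_l1.rep_eq)

text \<open>The partial sum is \<open>x\<close> with all coordinates from \<open>J\<close> on
  replaced by 0. As tails tend to 0, finite combinations of unit vectors are dense.\<close>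

lemma norm_diff_partial_expansion:
  "norm (x - (\<Sum>j<J. l1_scale (l1_nth x j) (l1_unit j))) = l1_tail J x"
proof -
  let ?z = "x - (\<Sum>j<J. l1_scale (l1_nth x j) (l1_unit j))"
  have z: "l1_nth ?z n = (if n < J then 0 else l1_nth x n)" for n
    by (simp add: minus_l1.rep_eq l1_nth_sum l1_scale.rep_eq l1_unit.rep_eq if_distrib cong: if_cong)
  have "l1_tail J ?z = l1_tail J x" by (simp add: l1_tail_def z)
  then show ?thesis using l1_tail_split[of ?z J] by (simp add: z)
qed

text \<open>Tails are subadditive and homogeneous under \<open>l1_scale\<close>, so for finite
  combinations of unit vectors the bound follows from the columns. Cutting \<open>x\<close> after
  \<open>J\<close> coordinates costs at most \<open>norm T * l1_tail J x\<close>, which vanishes in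
  the limit.\<close>

lemma l1_tail_apply_le:
  assumes T: "T \<in> l1_operators" and col: "\<And>j. l1_tail N (blinfun_apply T (l1_unit j)) \<le> M"
  shows "l1_tail N (blinfun_apply T x) \<le> M * norm x"
proof (rule LIMSEQ_le_const)
  have "(\<lambda>J. M * norm x + norm T * l1_tail J x) \<longlonglongrightarrow> M * norm x + norm T * 0"
    by (intro tendsto_intros l1_tail_tendsto_0)
  then show "(\<lambda>J. M * norm x + norm T * l1_tail J x) \<longlonglongrightarrow> M * norm x" by simp
  have "0 \<le> M" using col l1_tail_nonneg order_trans by blast
  have "l1_tail N (blinfun_apply T x) \<le> M * norm x + norm T * l1_tail J x" for J
  proof -
    let ?x = "\<Sum>j<J. l1_scale (l1_nth x j) (l1_unit j)"
    have "l1_tail N (blinfun_apply T ?x) \<le> (\<Sum>j<J. norm (l1_nth x j) * l1_tail N (blinfun_apply T (l1_unit j)))"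
      using T l1_tail_sum[of N "\<lambda>j. l1_scale (l1_nth x j) (blinfun_apply T (l1_unit j))" "{..<J}"]
      by (simp add: blinfun.sum_right l1_operators_def l1_tail_l1_scale)
    also have "\<dots> \<le> (\<Sum>j<J. norm (l1_nth x j) * M)"
      by (intro sum_mono mult_left_mono col) simp
    also have "\<dots> = M * (\<Sum>j<J. norm (l1_nth x j))"
      by (simp add: sum_distrib_left mult.commute)
    also have "\<dots> \<le> M * norm x"
      using \<open>0 \<le> M\<close> by (intro mult_left_mono sum_norm_l1_le)
    finally have 1: "l1_tail N (blinfun_apply T ?x) \<le> M * norm x" .
    have "norm (blinfun_apply T x - blinfun_apply T ?x) \<le> norm T * l1_tail J x"
      using norm_blinfun[of T "x - ?x"]
      by (simp add: norm_diff_partial_expansion blinfun.diff_right)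
    then show ?thesis
      using 1 l1_tail_le_add_dist[of N "blinfun_apply T x" "blinfun_apply T ?x"] by simp
  qed
  then show "\<exists>n. \<forall>J\<ge>n. l1_tail N (blinfun_apply T x) \<le> M * norm x + norm T * l1_tail J x"
    by blast
qed

text \<open>The case \<open>N = 0\<close> of \<open>l1_tail_apply_le\<close>. Together with
  \<open>norm_column_le\<close> it makes the operator norm the supremum of the column norms.\<close>

lemma norm_l1_operator_le:
  assumes "T \<in> l1_operators" and "\<And>j. norm (blinfun_apply T (l1_unit j)) \<le> M"
  shows "norm T \<le> M"
proof (rule norm_blinfun_bound)
  show "0 \<le> M" using assms(2)[of 0] norm_ge_zero order_trans by blast
  show "norm (blinfun_apply T x) \<le> M * norm x" for x
    using l1_tail_apply_le[of T 0 M x] assms by (simp add: l1_tail_0)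
qed

lemma norm_column_le: "norm (blinfun_apply T (l1_unit j)) \<le> norm T"
  using norm_blinfun[of T "l1_unit j"] by simp

lemma norm_column_diff_le:
  "norm (blinfun_apply S (l1_unit j) - blinfun_apply T (l1_unit j)) \<le> norm (S - T)"
  using norm_column_le[of "S - T" j] by (simp add: blinfun.diff_left)

text \<open>The columns are images of points of the unit ball, so compactness makes their tails
  uniformly small. Conversely \<open>l1_tail_apply_le\<close> spreads a column bound over the image
  of the whole ball with the same \<open>N\<close> and \<open>e\<close>.\<close>

lemma l1_compact_operators_iff:
  "T \<in> l1_compact_operators \<longleftrightarrow> T \<in> l1_operators \<and>
     (\<forall>e>0. \<exists>N. \<forall>j. l1_tail N (blinfun_apply T (l1_unit j)) \<le> e)"
  (is "_ \<longleftrightarrow> _ \<and> ?tails")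
proof -
  let ?S = "blinfun_apply T ` cball 0 1"
  have ?tails if c: "compact (closure ?S)"
  proof (intro allI impI)
    fix e :: real assume "0 < e"
    then obtain N where N: "\<And>y. y \<in> closure ?S \<Longrightarrow> l1_tail N y \<le> e"
      using compact_imp_uniform_l1_tail[OF c] by blast
    have "blinfun_apply T (l1_unit j) \<in> closure ?S" for j
      by (rule subsetD[OF closure_subset]) simp
    with N show "\<exists>N. \<forall>j. l1_tail N (blinfun_apply T (l1_unit j)) \<le> e" by blast
  qed
  moreover have "compact (closure ?S)" if T: "T \<in> l1_operators" and tl: ?tails
  proof (rule compact_closure_if_uniform_l1_tail)
    show "norm y \<le> norm T" if "y \<in> ?S" for y
      using that by (auto intro!: order_trans[OF norm_blinfun] mult_left_le)
    show "\<exists>N. \<forall>y\<in>?S. l1_tail N y \<le> e" if e: "0 < e" for e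
    proof -
      obtain N where N: "\<And>j. l1_tail N (blinfun_apply T (l1_unit j)) \<le> e" using tl e by blast
      have "l1_tail N (blinfun_apply T x) \<le> e" if "norm x \<le> 1" for x
        using l1_tail_apply_le[OF T N, of x] mult_left_le[OF that less_imp_le[OF e]] by simp
      then have "\<forall>y\<in>?S. l1_tail N y \<le> e" by auto
      then show ?thesis by blast
    qed
  qed
  ultimately show ?thesis by (auto simp: l1_compact_operators_def)
qed

section \<open>Operators and compact operators as closed subspaces\<close>

lemma l1_scale_add_right: "l1_scale c (x + y) = l1_scale c x + l1_scale c y"
  by transfer (simp add: fun_eq_iff algebra_simps)

lemma l1_scale_zero_right [simp]: "l1_scale c 0 = 0"
  by transfer simp

lemma l1_scale_scaleR_right: "l1_scale c (r *\<^sub>R x) = r *\<^sub>R l1_scale c x"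
  by transfer simp

lemma subspace_l1_operators: "subspace l1_operators"
  by (auto simp: subspace_def l1_operators_def blinfun.add_left blinfun.scaleR_left
      l1_scale_add_right l1_scale_scaleR_right)

lemma closed_l1_operators: "closed (l1_operators :: ('k::{real_normed_field,heine_borel} l1 \<Rightarrow>\<^sub>L 'k l1) set)"
proof -
  have "continuous_on UNIV (\<lambda>T :: 'k l1 \<Rightarrow>\<^sub>L 'k l1. l1_scale c (blinfun_apply T x))" for c x
  proof -
    have "bounded_linear (l1_scale c :: 'k l1 \<Rightarrow> _)"
      by (rule bounded_linear_intro[where K = "norm c"])
        (simp_all add: l1_scale_add_right l1_scale_scaleR_right norm_l1_scale mult.commute)
    then show ?thesis
      by (rule bounded_linear.continuous_on) (intro continuous_intros)
  qed
  then show ?thesis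
    unfolding l1_operators_def by (intro closed_Collect_all closed_Collect_eq continuous_intros)
qed

lemma subspace_l1_compact_operators: "subspace l1_compact_operators"
proof (rule subspaceI)
  show "0 \<in> l1_compact_operators"
    using subspace_0[OF subspace_l1_operators] by (auto simp: l1_compact_operators_iff intro: less_imp_le)
next
  fix S T :: "'a l1 \<Rightarrow>\<^sub>L 'a l1"
  assume S: "S \<in> l1_compact_operators" and T: "T \<in> l1_compact_operators"
  have "\<exists>N. \<forall>j. l1_tail N (blinfun_apply (S + T) (l1_unit j)) \<le> e" if "0 < e" for e
  proof -
    obtain N M where NM: "\<And>j. l1_tail N (blinfun_apply S (l1_unit j)) \<le> e/2"
        "\<And>j. l1_tail M (blinfun_apply T (l1_unit j)) \<le> e/2"
      using S T \<open>0 < e\<close> unfolding l1_compact_operators_iff by (meson half_gt_zero)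
    have "l1_tail (max N M) (blinfun_apply (S + T) (l1_unit j)) \<le> e" for j
      using l1_tail_triangle[of "max N M" "blinfun_apply S (l1_unit j)" "blinfun_apply T (l1_unit j)"]
        l1_tail_antimono[OF max.cobounded1[of N M], of "blinfun_apply S (l1_unit j)"]
        l1_tail_antimono[OF max.cobounded2[of M N], of "blinfun_apply T (l1_unit j)"]
        NM[of j]
      by (simp add: blinfun.add_left)
    then show ?thesis by blast
  qed
  then show "S + T \<in> l1_compact_operators"
    using S T subspace_add[OF subspace_l1_operators] by (auto simp: l1_compact_operators_iff)
next
  fix r and T :: "'a l1 \<Rightarrow>\<^sub>L 'a l1"
  assume T: "T \<in> l1_compact_operators"
  have "\<exists>N. \<forall>j. l1_tail N (blinfun_apply (r *\<^sub>R T) (l1_unit j)) \<le> e" if "0 < e" for e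
  proof -
    \<comment> \<open>Adding 1 keeps the divisor positive when \<open>r = 0\<close>.\<close>
    have "0 < e / (\<bar>r\<bar> + 1)" using that by simp
    then obtain N where N: "\<And>j. l1_tail N (blinfun_apply T (l1_unit j)) \<le> e / (\<bar>r\<bar> + 1)"
      using T unfolding l1_compact_operators_iff by blast
    have "\<bar>r\<bar> * l1_tail N (blinfun_apply T (l1_unit j)) \<le> (\<bar>r\<bar> + 1) * (e / (\<bar>r\<bar> + 1))" for j
      using that by (intro mult_mono N) (simp_all add: l1_tail_nonneg)
    then show ?thesis
      by (auto simp: blinfun.scaleR_left l1_tail_scaleR)
  qed
  then show "r *\<^sub>R T \<in> l1_compact_operators"
    using T subspace_scale[OF subspace_l1_operators] by (auto simp: l1_compact_operators_iff)
qed

text \<open>The positive slack \<open>d - norm (T - C)\<close> is the tail bound demanded of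
  \<open>C\<close>. Serves closedness with arbitrarily small \<open>d\<close>, and the trimming with
  \<open>d\<close> just above the distance to the compact operators.\<close>

lemma uniform_column_tail_near_compact:
  assumes "C \<in> l1_compact_operators" "norm (T - C) < d"
  shows "\<exists>N. \<forall>j. l1_tail N (blinfun_apply T (l1_unit j)) \<le> d"
proof -
  obtain N where N: "\<And>j. l1_tail N (blinfun_apply C (l1_unit j)) \<le> d - norm (T - C)"
    using assms unfolding l1_compact_operators_iff by (meson diff_gt_0_iff_gt)
  have "l1_tail N (blinfun_apply T (l1_unit j)) \<le> d" for j
    using N[of j] norm_column_diff_le[of T j C]
      l1_tail_le_add_dist[of N "blinfun_apply T (l1_unit j)" "blinfun_apply C (l1_unit j)"] by simp
  then show ?thesis by blast
qed

lemma closed_l1_compact_operators: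
  "closed (l1_compact_operators :: ('k::{real_normed_field,heine_borel} l1 \<Rightarrow>\<^sub>L 'k l1) set)"
proof (rule closed_limpt[THEN iffD2], intro allI impI)
  fix T :: "'k l1 \<Rightarrow>\<^sub>L 'k l1" assume T: "T islimpt l1_compact_operators"
  then have "T islimpt l1_operators"
    by (rule islimpt_subset) (auto simp: l1_compact_operators_def)
  then have "T \<in> l1_operators"
    using closed_l1_operators closed_limpt by blast
  moreover have "\<exists>N. \<forall>j. l1_tail N (blinfun_apply T (l1_unit j)) \<le> e" if "0 < e" for e
  proof -
    obtain C where "C \<in> l1_compact_operators" "norm (T - C) < e"
      using T \<open>0 < e\<close> unfolding islimpt_approachable by (auto simp: dist_norm norm_minus_commute)
    then show ?thesis by (rule uniform_column_tail_near_compact)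
  qed
  ultimately show "T \<in> l1_compact_operators" by (simp add: l1_compact_operators_iff)
qed

text \<open>The operator is the matrix with columns \<open>c j\<close>; uniformly bounded columns
  make every row series converge absolutely.\<close>

lemma l1_operator_with_columns:
  fixes c :: "nat \<Rightarrow> 'k::{real_normed_field,heine_borel} l1"
  assumes c: "\<And>j. norm (c j) \<le> M"
  obtains T where "T \<in> l1_operators" "\<And>j. blinfun_apply T (l1_unit j) = c j"
proof -
  have "0 \<le> M" using c[of 0] norm_ge_zero order_trans by blast
  \<comment> \<open>The contribution of column \<open>j\<close> to coordinate \<open>n\<close> of
    the image of \<open>x\<close>.\<close>
  define g where "g x n j = l1_nth x j * l1_nth (c j) n" for x n j
  have gs: "summable (\<lambda>j. norm (g x n j))" for x n
  proof (rule summable_comparison_test')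
    show "summable (\<lambda>j. norm (l1_nth x j) * M)"
      using summable_l1_nth by (rule summable_mult2)
    show "norm (norm (g x n j)) \<le> norm (l1_nth x j) * M" if "0 \<le> j" for j
      using order_trans[OF norm_l1_nth_le c] by (simp add: g_def norm_mult mult_left_mono)
  qed
  note gsum = summable_norm_cancel_complete[OF gs]
  \<comment> \<open>Only finitely many rows are summed, so the sum moves inside the series over the
    columns. Being uniform in \<open>K\<close>, the bound yields both summability and the norm
    estimate.\<close>
  have bound: "(\<Sum>n<K. norm (suminf (g x n))) \<le> norm x * M" for x K
  proof -
    have "(\<Sum>n<K. norm (suminf (g x n))) \<le> (\<Sum>n<K. \<Sum>j. norm (g x n j))"
      by (intro sum_mono norm_suminf_le_complete gs)
    also have "\<dots> = (\<Sum>j. \<Sum>n<K. norm (g x n j))"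
      by (intro suminf_sum[symmetric] gs)
    also have "\<dots> \<le> (\<Sum>j. norm (l1_nth x j) * M)"
    proof (intro suminf_le summable_sum gs summable_mult2 summable_l1_nth)
      fix j
      have "(\<Sum>n<K. norm (g x n j)) = norm (l1_nth x j) * (\<Sum>n<K. norm (l1_nth (c j) n))"
        by (simp add: g_def norm_mult sum_distrib_left)
      also have "\<dots> \<le> norm (l1_nth x j) * M"
        by (intro mult_left_mono order_trans[OF sum_norm_l1_le c]) simp
      finally show "(\<Sum>n<K. norm (g x n j)) \<le> norm (l1_nth x j) * M" .
    qed
    also have "\<dots> = norm x * M"
      by (simp add: norm_l1.rep_eq suminf_mult2[OF summable_l1_nth])
    finally show ?thesis .
  qed
  have summ: "summable (\<lambda>n. norm (suminf (g x n)))" for x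
    using bound by (intro bounded_imp_summable[where B = "norm x * M"])
      (auto simp: lessThan_Suc_atMost[symmetric] simp del: sum.lessThan_Suc)
  define F where "F x = Abs_l1 (\<lambda>n. suminf (g x n))" for x
  have F: "l1_nth (F x) n = suminf (g x n)" for x n
    using summ[of x] by (simp add: F_def Abs_l1_inverse)
  have F_scale: "F (l1_scale a x) = l1_scale a (F x)" for a x
  proof -
    have "g (l1_scale a x) n = (\<lambda>j. a * g x n j)" for n
      by (simp add: fun_eq_iff g_def l1_scale.rep_eq mult.assoc)
    then show ?thesis
      by (intro l1_eqI) (simp add: F l1_scale.rep_eq suminf_mult[OF gsum])
  qed
  have bl: "bounded_linear F"
  proof (rule bounded_linear_intro)
    show "F (x + y) = F x + F y" for x y
    proof -
      have "g (x + y) n = (\<lambda>j. g x n j + g y n j)" for n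
        by (simp add: fun_eq_iff g_def plus_l1.rep_eq algebra_simps)
      then show ?thesis
        by (intro l1_eqI) (simp add: F plus_l1.rep_eq suminf_add[OF gsum gsum])
    qed
    show "F (r *\<^sub>R x) = r *\<^sub>R F x" for r x
    proof -
      \<comment> \<open>Real scalars act through \<open>of_real\<close>, so real homogeneity is a
        case of \<open>F_scale\<close>.\<close>
      have "r *\<^sub>R z = l1_scale (of_real r) z" for z :: "'k l1"
        by transfer (simp add: scaleR_conv_of_real)
      then show ?thesis using F_scale by simp
    qed
    show "norm (F x) \<le> norm x * M" for x
      using suminf_le_const[OF summ bound] by (simp add: norm_l1.rep_eq[of "F x"] F)
  qed
  show ?thesis
  proof (rule that[of "Blinfun F"])
    show "Blinfun F \<in> l1_operators"
      using F_scale by (simp add: l1_operators_def bounded_linear_Blinfun_apply[OF bl])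
    have "F (l1_unit j) = c j" for j
    proof (rule l1_eqI)
      fix n
      have "g (l1_unit j) n = (\<lambda>i. if i = j then l1_nth (c i) n else 0)"
        by (auto simp: g_def l1_unit.rep_eq)
      then show "l1_nth (F (l1_unit j)) n = l1_nth (c j) n"
        using sums_single[of j "\<lambda>i. l1_nth (c i) n"] by (simp add: F sums_iff)
    qed
    then show "blinfun_apply (Blinfun F) (l1_unit j) = c j" for j
      by (simp add: bounded_linear_Blinfun_apply[OF bl])
  qed
qed

section \<open>Trimming the columns\<close>

text \<open>Mass is removed from the far end, so every tail loses \<open>d\<close> or becomes 0.
  Prescribing all tails fixes the moduli of the coordinates of \<open>y\<close> as differences of
  consecutive tails.\<close>

lemma l1_trim:
  fixes x :: "'k::real_normed_field l1"
  assumes "0 \<le> d"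
  obtains y where "\<And>N. l1_tail N y = max (l1_tail N x - d) 0" "norm (x - y) \<le> d"
proof -
  \<comment> \<open>\<open>h\<close> is the tail function that \<open>y\<close> is to have;
    \<open>sgn\<close> below keeps the phase of each coordinate of \<open>x\<close>.\<close>
  define h where "h n = max (l1_tail n x - d) 0" for n
  define y where "y n = (h n - h (Suc n)) *\<^sub>R sgn (l1_nth x n)" for n
  have h: "0 \<le> h n - h (Suc n)" "h n - h (Suc n) \<le> norm (l1_nth x n)" for n
    using l1_tail_Suc[of n x] norm_ge_zero[of "l1_nth x n"] unfolding h_def by linarith+
  \<comment> \<open>Where \<open>x\<close> vanishes \<open>sgn\<close> is 0, but there the bounds on
    \<open>h\<close> force the decrement to be 0 as well.\<close>
  have norm_y: "norm (y n) = h n - h (Suc n)" for n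
    using h[of n] by (auto simp: y_def norm_sgn)
  have "norm (l1_nth x n - y n) = norm (l1_nth x n) - (h n - h (Suc n))" for n
  proof -
    have "l1_nth x n = norm (l1_nth x n) *\<^sub>R sgn (l1_nth x n)"
      by (cases "l1_nth x n = 0") (simp_all add: sgn_div_norm)
    then have "l1_nth x n - y n = (norm (l1_nth x n) - (h n - h (Suc n))) *\<^sub>R sgn (l1_nth x n)"
      unfolding y_def by (metis scaleR_left_diff_distrib)
    then show ?thesis using h[of n] by (auto simp: norm_sgn)
  qed
  then have norm_xy: "norm (l1_nth x n - y n) = (l1_tail n x - h n) - (l1_tail (Suc n) x - h (Suc n))" for n
    using l1_tail_Suc[of n x] by simp
  have "h \<longlonglongrightarrow> max (0 - d) 0"
    unfolding h_def by (intro tendsto_intros l1_tail_tendsto_0)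
  \<comment> \<open>Here \<open>0 \<le> d\<close> enters: the limit is 0, so the decrements of
    \<open>h\<close> telescope to exactly \<open>h N\<close>.\<close>
  then have h0: "h \<longlonglongrightarrow> 0" using assms by (simp add: max_def)
  have sums: "(\<lambda>i. norm (y (i + N))) sums h N" for N
    using telescope_sums'[OF LIMSEQ_ignore_initial_segment[OF h0, of N]] by (simp add: norm_y)
  have "summable (\<lambda>n. norm (y n))"
    using sums[of 0] by (simp add: sums_iff)
  then have Y: "l1_nth (Abs_l1 y) = y" by (simp add: Abs_l1_inverse)
  \<comment> \<open>The removed mass telescopes too, to \<open>l1_tail 0 x - h 0\<close>, the
    smaller of \<open>norm x\<close> and \<open>d\<close>.\<close>
  have "(\<lambda>n. norm (l1_nth x n - y n)) sums ((l1_tail 0 x - h 0) - (0 - 0))"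
    unfolding norm_xy by (intro telescope_sums' tendsto_diff l1_tail_tendsto_0 h0)
  then have "norm (x - Abs_l1 y) = l1_tail 0 x - h 0"
    by (simp add: norm_l1.rep_eq minus_l1.rep_eq Y sums_iff)
  then have "norm (x - Abs_l1 y) \<le> d"
    by (simp add: h_def)
  moreover have "l1_tail N (Abs_l1 y) = max (l1_tail N x - d) 0" for N
    using sums[of N] by (simp add: l1_tail_def[of N "Abs_l1 y"] Y sums_iff h_def)
  ultimately show ?thesis by (intro that)
qed

text \<open>All columns are trimmed by the same \<open>d\<close>. The first bound on
  \<open>d\<close> brings the norm down to 1, the second makes the result compact.\<close>

lemma compact_approximation_in_unit_ball:
  fixes T :: "'k::{real_normed_field,heine_borel} l1 \<Rightarrow>\<^sub>L 'k l1"
  assumes T: "T \<in> l1_operators"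
    and d: "norm T - 1 \<le> d" "infdist T l1_compact_operators \<le> d"
  obtains K where "K \<in> unit_ball l1_compact_operators" "norm (T - K) \<le> d"
proof -
  have "0 \<le> d" using d(2) infdist_nonneg order_trans by blast
  then have "\<forall>j. \<exists>y. (\<forall>N. l1_tail N y = max (l1_tail N (blinfun_apply T (l1_unit j)) - d) 0)
      \<and> norm (blinfun_apply T (l1_unit j) - y) \<le> d"
    by (metis l1_trim)
  then obtain c where tail_c: "\<And>j N. l1_tail N (c j) = max (l1_tail N (blinfun_apply T (l1_unit j)) - d) 0"
    and near: "\<And>j. norm (blinfun_apply T (l1_unit j) - c j) \<le> d"
    by metis
  \<comment> \<open>The case \<open>N = 0\<close> of \<open>tail_c\<close>, as
    \<open>norm T - d\<close> is at most 1.\<close>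
  have c1: "norm (c j) \<le> 1" for j
    using tail_c[of 0 j] norm_column_le[of T j] d(1) by (simp add: l1_tail_0)
  then obtain K where K: "K \<in> l1_operators" and col: "\<And>j. blinfun_apply K (l1_unit j) = c j"
    using l1_operator_with_columns by blast
  have "\<exists>N. \<forall>j. l1_tail N (c j) \<le> e" if "0 < e" for e
  proof -
    \<comment> \<open>\<open>infdist\<close> to the empty set is 0 by definition; nonemptiness makes
      it a true infimum, which \<open>d + e\<close> exceeds.\<close>
    have ne: "l1_compact_operators \<noteq> ({} :: ('k l1 \<Rightarrow>\<^sub>L 'k l1) set)"
      using subspace_0[OF subspace_l1_compact_operators] by blast
    then have "\<exists>C\<in>l1_compact_operators. dist T C < d + e"
      using d(2) \<open>0 < e\<close> cInf_lessD[of "dist T ` l1_compact_operators" "d + e"]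
      by (auto simp: infdist_def)
    then obtain C where "C \<in> l1_compact_operators" "norm (T - C) < d + e"
      by (auto simp: dist_norm)
    then obtain N where "\<And>j. l1_tail N (blinfun_apply T (l1_unit j)) \<le> d + e"
      using uniform_column_tail_near_compact by blast
    \<comment> \<open>Trimming takes \<open>d\<close> off a tail of at most
      \<open>d + e\<close>.\<close>
    then have "l1_tail N (c j) \<le> e" for j
      using \<open>0 < e\<close> by (simp add: tail_c diff_le_eq add.commute)
    then show ?thesis by blast
  qed
  then have "K \<in> l1_compact_operators" by (simp add: l1_compact_operators_iff K col)
  moreover have "norm K \<le> 1" using K c1 by (intro norm_l1_operator_le) (simp_all add: col)
  moreover have "norm (T - K) \<le> d"
    using subspace_diff[OF subspace_l1_operators T K] near
    by (intro norm_l1_operator_le) (simp_all add: col blinfun.diff_left)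
  ultimately show ?thesis by (intro that) (simp_all add: unit_ball_def)
qed

section \<open>The distance formula and its attainment\<close>

theorem mainTheorem4:
  shows "ball_proximinal_in
           (l1_compact_operators :: ('k::{real_normed_field,heine_borel} l1 \<Rightarrow>\<^sub>L 'k l1) set)
           l1_operators \<and>
         (\<forall>T \<in> (l1_operators :: ('k l1 \<Rightarrow>\<^sub>L 'k l1) set).
            infdist T (unit_ball l1_compact_operators)
              = max (norm T - 1) (infdist T l1_compact_operators))"
proof -
  let ?K = "l1_compact_operators :: ('k l1 \<Rightarrow>\<^sub>L 'k l1) set"
  \<comment> \<open>Nonemptiness of the ball, required for proximinality and for
    \<open>infdist\<close> to be an infimum.\<close>
  have zero: "0 \<in> unit_ball ?K"
    using subspace_0[OF subspace_l1_compact_operators] by (simp add: unit_ball_def)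
  have "unit_ball ?K = ?K \<inter> cball 0 1" by (auto simp: unit_ball_def)
  then have closed: "closed (unit_ball ?K)" using closed_l1_compact_operators by auto
  have sub: "?K \<subseteq> l1_operators" "unit_ball ?K \<subseteq> ?K"
    by (auto simp: l1_compact_operators_def unit_ball_def)
  have lower: "max (norm T - 1) (infdist T ?K) \<le> infdist T (unit_ball ?K)" for T
  proof -
    have "norm T - 1 \<le> dist T C" if "C \<in> unit_ball ?K" for C
      using that norm_triangle_ineq2[of T C] by (simp add: unit_ball_def dist_norm)
    then have "norm T - 1 \<le> infdist T (unit_ball ?K)"
      using zero unfolding infdist_def by (auto intro!: cINF_greatest)
    moreover have "infdist T ?K \<le> infdist T (unit_ball ?K)"
      using zero sub(2) by (intro infdist_mono) auto
    ultimately show ?thesis by simp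
  qed
  \<comment> \<open>With the maximum itself as \<open>d\<close>, the constructed operator meets the
    lower bound, which gives the formula and a nearest point at once.\<close>
  have attained: "\<exists>C\<in>unit_ball ?K. norm (T - C) \<le> max (norm T - 1) (infdist T ?K)"
    if "T \<in> l1_operators" for T
    using compact_approximation_in_unit_ball[OF that max.cobounded1 max.cobounded2] by blast
  have upper: "infdist T (unit_ball ?K) \<le> norm (T - C)" if "C \<in> unit_ball ?K" for T C
    using infdist_le[OF that] by (simp add: dist_norm)
  have dist_eq: "infdist T (unit_ball ?K) = max (norm T - 1) (infdist T ?K)" if "T \<in> l1_operators" for T
    using attained[OF that] lower[of T] upper[of _ T] by (meson antisym order_trans)
  have "\<exists>C\<in>unit_ball ?K. norm (T - C) = infdist T (unit_ball ?K)" if "T \<in> l1_operators" for T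
    using attained[OF that] upper[of _ T] dist_eq[OF that] by (metis antisym)
  then have "proximinal_in (unit_ball ?K) l1_operators"
    unfolding proximinal_in_def using zero closed sub by blast
  then show ?thesis
    using subspace_l1_compact_operators closed_l1_compact_operators sub(1) dist_eq
    by (simp add: ball_proximinal_in_def)
qed

end
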